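(* Let $\mathcal A=(A_1,\dots,A_q)$ be a normalized tuple of finite nonempty sets of integers with $a_i^*:=\max A_i\ge1$ for every $i$. Fix $t,r\in\mathbb N$. Then there exists a threshold vector $\mathbf h_{r,t}\in\mathbb N_0^q$ such that for every $\mathbf h\succeq\mathbf h_{r,t}$ there exists a set $X_{\mathbf h}\subseteq\mathbb Z$ with $|X_{\mathbf h}|\le r+2$ and \[ ((r\mathbf h)\cdot\mathcal A)^{(t)}\subseteq X_{\mathbf h}+(\mathbf h\cdot\mathcal A)^{(t)}. \]
   Context: $\mathbb N=\{1,2,\dots\}$, $\mathbb N_0=\{0,1,2,\dots\}$. For $\mathbf h=(h_1,\dots,h_q)\in\mathbb N_0^q$, $r\mathbf h=(rh_1,\dots,rh_q)$ and $\mathbf h\preceq\mathbf h'$ means $h_i\le h_i'$ for all $i$. A tuple of finite nonempty integer sets is normalized if $\min A_i=0$ for all $i$ and $\gcd\bigl(\bigcup_i A_i\bigr)=1$. The chromatic representation function $r_{\mathcal A,\mathbf h}(n)$ is the number of tuples $(a_{1,1},\dots,a_{1,h_1};\dots;a_{q,1},\dots,a_{q,h_q})$ with $a_{i,j}\in A_i$ for all $i,j$, $a_{i,1}\le a_{i,2}\le\cdots\le a_{i,h_i}$ for each $i$, and $\sum_{i=1}^q\sum_{j=1}^{h_i}a_{i,j}=n$. For $t\in\mathbb N$, the threshold-$t$ chromatic layer is $(\mathbf h\cdot\mathcal A)^{(t)}=\{n\in\mathbb Z:r_{\mathcal A,\mathbf h}(n)\ge t\}$. For $X,Y\subseteq\mathbb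 Z$, $X+Y=\{x+y:x\in X,y\in Y\}$. *)

theory Defs
  imports "HOL-Library.FuncSet" "HOL-Library.Set_Algebras"
begin

text \<open>
  A q-tuple is a function on a finite index type \<open>'q\<close> with q elements (so q is at least 1; the empty
  tuple is never normalized, as the gcd of the empty set is 0).  Accordingly the componentwise
  order on tuples of naturals is the pointwise order \<open>\<le>\<close> on \<open>'q \<Rightarrow> nat\<close>.
\<close>

definition normalized :: "('q::finite \<Rightarrow> int set) \<Rightarrow> bool" where
  "normalized A \<longleftrightarrow> (\<forall>i. Min (A i) = 0) \<and> Gcd (\<Union>i. A i) = 1"

text \<open>The list \<open>a i\<close> is \<open>[a\<^bsub>i,1\<^esub>, \<dots>, a\<^bsub>i,h i\<^esub>]\<close>.\<close>

definition chromatic_reps :: "('q::finite \<Rightarrow> int set) \<Rightarrow> ('q \<Rightarrow> nat) \<Rightarrow> int \<Rightarrow> ('q \<Rightarrow> int list) set" where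
  "chromatic_reps A h n =
     {a. (\<forall>i. length (a i) = h i \<and> set (a i) \<subseteq> A i \<and> sorted (a i)) \<and>
         (\<Sum>i\<in>UNIV. sum_list (a i)) = n}"

definition chromatic_rep_count :: "('q::finite \<Rightarrow> int set) \<Rightarrow> ('q \<Rightarrow> nat) \<Rightarrow> int \<Rightarrow> nat" where
  "chromatic_rep_count A h n = card (chromatic_reps A h n)"

definition chromatic_layer :: "nat \<Rightarrow> ('q::finite \<Rightarrow> nat) \<Rightarrow> ('q \<Rightarrow> int set) \<Rightarrow> int set" where
  "chromatic_layer t h A = {n. chromatic_rep_count A h n \<ge> t}"

text \<open>
  \<open>card\<close> of an infinite set is 0, but for finite \<open>A i\<close> (the only case of interest) the set of
  representations is finite, so the count is the intended one.
\<close>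

lemma finite_chromatic_reps:
  fixes A :: "'q::finite \<Rightarrow> int set"
  assumes "\<And>i. finite (A i)"
  shows "finite (chromatic_reps A h n)"
proof -
  have "finite (Pi\<^sub>E UNIV (\<lambda>i. {xs. set xs \<subseteq> A i \<and> length xs = h i}))"
    by (intro finite_PiE finite_lists_length_eq assms finite_UNIV)
  moreover have "chromatic_reps A h n \<subseteq> Pi\<^sub>E UNIV (\<lambda>i. {xs. set xs \<subseteq> A i \<and> length xs = h i})"
    by (auto simp: chromatic_reps_def)
  ultimately show ?thesis
    by (rule finite_subset[rotated])
qed

end

(*
  Write M(h) for the sum of the h_i max A_i. Representations may be padded by 0 or by max A_i, so
  once some layer L(h0) contains a run of consecutive integers of length at least max_i max A_i,
  every L(h) with h >= h0 contains an interval [c, M(h) - d] with c, d independent of h. Such a run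
  exists as soon as some layer is nonempty: the sumset semigroup contains two consecutive integers
  because the gcd is 1, and adding a fixed representation never decreases the count.
  Below c the count does not depend on h (almost all summands are 0), and above r M(h) - d neither,
  by the reflection x -> max A_i - x. Hence the translates by 0 and (r - 1) M(h) cover the two ends
  of the layer of r h, and the translates by 0, w, ..., r w with w = M(h) - d - c + 1 its middle.
*)
theory Submission
  imports Defs "HOL-Library.Multiset"
begin

section \<open>Sums and leading zeros of integer lists\<close>

lemma sum_list_minus_const:
  fixes m :: "'a::ring_1"
  shows "(\<Sum>x\<leftarrow>xs. m - x) = of_nat (length xs) * m - sum_list xs"
  by (induction xs) (auto simp: algebra_simps)

text \<open>Each nonzero entry contributes at least 1 to the sum, so at least \<open>k\<close>
  entries vanish, and sorting puts them in front.\<close>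

lemma take_sorted_eq_replicate_0:
  fixes xs :: "int list"
  assumes "sorted xs" "\<And>x. x \<in> set xs \<Longrightarrow> 0 \<le> x" "sum_list xs + int k \<le> int (length xs)"
  shows "take k xs = replicate k 0"
  using assms
proof (induction xs arbitrary: k)
  case Nil
  then show ?case by simp
next
  case (Cons x xs)
  show ?case
  proof (cases k)
    case (Suc l)
    have "x = 0"
    proof (rule ccontr)
      assume "x \<noteq> 0"
      with Cons.prems have "\<And>y. y \<in> set (x # xs) \<Longrightarrow> 1 \<le> y"
        by fastforce
      then have "(\<Sum>y\<leftarrow>x # xs. 1) \<le> (\<Sum>y\<leftarrow>x # xs. y)"
        by (intro sum_list_mono)
      then have "int (length (x # xs)) \<le> sum_list (x # xs)"
        by (simp add: sum_list_triv)
      with Cons.prems(3) Suc show False by simp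
    qed
    with Cons Suc show ?thesis by simp
  qed simp
qed

section \<open>Adding and padding representations\<close>

lemma mem_chromatic_layer_1_iff:
  fixes A :: "'q::finite \<Rightarrow> int set"
  assumes "\<And>i. finite (A i)"
  shows "n \<in> chromatic_layer 1 h A \<longleftrightarrow> chromatic_reps A h n \<noteq> {}"
  using finite_chromatic_reps[where h = h and n = n, OF assms]
  by (auto simp: chromatic_layer_def chromatic_rep_count_def Suc_le_eq card_gt_0_iff)

text \<open>Merge one fixed representation \<open>b\<close> of \<open>n'\<close> into every
  representation of \<open>n\<close> and sort again. This is injective: a sorted list is determined
  by its multiset, and \<open>b i\<close> cancels in multisets. Hence the count does not
  drop.\<close>

lemma chromatic_layer_add:
  fixes A :: "'q::finite \<Rightarrow> int set"
  assumes fin: "\<And>i. finite (A i)"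
    and n: "n \<in> chromatic_layer t h A" and n': "n' \<in> chromatic_layer 1 h' A"
  shows "n + n' \<in> chromatic_layer t (\<lambda>i. h i + h' i) A"
proof -
  obtain b where b: "b \<in> chromatic_reps A h' n'"
    using n' mem_chromatic_layer_1_iff[of A, OF fin] by blast
  let ?f = "\<lambda>a i. sort (a i @ b i)"
  have "sum_list (sort (xs @ ys)) = sum_list xs + sum_list ys" for xs ys :: "int list"
    by (metis mset_sort sum_mset_sum_list sum_list_append)
  then have "?f ` chromatic_reps A h n \<subseteq> chromatic_reps A (\<lambda>i. h i + h' i) (n + n')"
    using b by (auto simp: chromatic_reps_def sum.distrib subset_iff)
  moreover have "inj_on ?f (chromatic_reps A h n)"
  proof (rule inj_onI, rule ext)
    fix a a' i
    assume a: "a \<in> chromatic_reps A h n" "a' \<in> chromatic_reps A h n" and eq: "?f a = ?f a'"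
    have "mset (a i @ b i) = mset (a' i @ b i)"
      using fun_cong[OF eq, of i] by (metis mset_sort)
    then have "mset (a i) = mset (a' i)" by simp
    then show "a i = a' i"
      using a by (metis (no_types, lifting) chromatic_reps_def mem_Collect_eq
          properties_for_sort sort_key_id_if_sorted map_ident sorted_sort_id)
  qed
  ultimately have "card (chromatic_reps A h n)
      \<le> card (chromatic_reps A (\<lambda>i. h i + h' i) (n + n'))"
    by (intro card_inj_on_le[of ?f] finite_chromatic_reps fin)
  with n show ?thesis
    by (simp add: chromatic_layer_def chromatic_rep_count_def)
qed

lemma chromatic_layer_single:
  fixes A :: "'q::finite \<Rightarrow> int set"
  assumes "\<And>i. finite (A i)" "x \<in> A i"
  shows "x \<in> chromatic_layer 1 (\<lambda>j. of_bool (j = i)) A"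
proof -
  have "(\<lambda>j. if j = i then [x] else []) \<in> chromatic_reps A (\<lambda>j. of_bool (j = i)) x"
    using assms(2) by (auto simp: chromatic_reps_def if_distrib cong: if_cong)
  then show ?thesis
    using mem_chromatic_layer_1_iff[of A, OF assms(1)] by blast
qed

lemma chromatic_layer_mono:
  fixes A :: "'q::finite \<Rightarrow> int set"
  assumes "\<And>i. finite (A i)" "\<And>i. 0 \<in> A i" "n \<in> chromatic_layer t h A" "h \<le> h'"
  shows "n \<in> chromatic_layer t h' A"
proof -
  have "(\<lambda>i. replicate (h' i - h i) 0) \<in> chromatic_reps A (\<lambda>i. h' i - h i) 0"
    using assms(2) by (auto simp: chromatic_reps_def sum_list_replicate)
  then have "0 \<in> chromatic_layer 1 (\<lambda>i. h' i - h i) A"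
    using mem_chromatic_layer_1_iff[of A, OF assms(1)] by blast
  from chromatic_layer_add[of A, OF assms(1) assms(3) this] show ?thesis
    using assms(4) by (simp add: le_fun_def)
qed

section \<open>Stability of the two ends of a layer\<close>

text \<open>A small total forces most summands to be 0: each \<open>a i\<close> starts with at least
  \<open>h' i - h i\<close> zeros, and dropping that many is injective because they can be put
  back.\<close>

lemma chromatic_layer_initial:
  fixes A :: "'q::finite \<Rightarrow> int set"
  assumes fin: "\<And>i. finite (A i)" and nonneg: "\<And>i x. x \<in> A i \<Longrightarrow> 0 \<le> x"
    and n: "n \<in> chromatic_layer t h' A" and le: "h \<le> h'" "\<And>i. n \<le> int (h i)"
  shows "n \<in> chromatic_layer t h A"
proof -
  let ?f = "\<lambda>a i. drop (h' i - h i) (a i)"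
  have split: "a i = replicate (h' i - h i) 0 @ ?f a i" if a: "a \<in> chromatic_reps A h' n" for a i
  proof -
    have pos: "0 \<le> x" if "x \<in> set (a i)" for i x
      using a nonneg that by (fastforce simp: chromatic_reps_def)
    \<comment> \<open>The other colours contribute nonnegative amounts, so the bound on
      \<open>n\<close> passes to every single list.\<close>
    have "sum_list (a i) \<le> (\<Sum>i\<in>UNIV. sum_list (a i))"
      using pos by (intro member_le_sum sum_list_nonneg) auto
    also have "\<dots> = n"
      using a by (simp add: chromatic_reps_def)
    finally have "sum_list (a i) \<le> int (h i)"
      using le(2)[of i] by linarith
    then have "take (h' i - h i) (a i) = replicate (h' i - h i) 0"
      using a pos le(1) by (intro take_sorted_eq_replicate_0)
        (auto simp: chromatic_reps_def le_fun_def of_nat_diff)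
    then show ?thesis by (metis append_take_drop_id)
  qed
  have sum: "sum_list (?f a i) = sum_list (a i)" if "a \<in> chromatic_reps A h' n" for a i
    using arg_cong[OF split[OF that], of sum_list] by (simp add: sum_list_replicate)
  have "?f a \<in> chromatic_reps A h n" if "a \<in> chromatic_reps A h' n" for a
    using that le(1) unfolding chromatic_reps_def
    by (auto simp: sum[OF that] le_fun_def sorted_wrt_drop dest: in_set_dropD)
  then have "?f ` chromatic_reps A h' n \<subseteq> chromatic_reps A h n"
    by blast
  moreover have "inj_on ?f (chromatic_reps A h' n)"
  proof (rule inj_onI, rule ext)
    fix a a' i
    assume a: "a \<in> chromatic_reps A h' n" "a' \<in> chromatic_reps A h' n" and eq: "?f a = ?f a'"
    have "a i = replicate (h' i - h i) 0 @ ?f a i"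
      by (rule split[OF a(1)])
    also have "?f a i = ?f a' i"
      using fun_cong[OF eq, of i] .
    also have "replicate (h' i - h i) 0 @ ?f a' i = a' i"
      by (rule split[OF a(2), symmetric])
    finally show "a i = a' i" .
  qed
  ultimately have "card (chromatic_reps A h' n) \<le> card (chromatic_reps A h n)"
    by (intro card_inj_on_le[of ?f] finite_chromatic_reps fin)
  with n show ?thesis
    by (simp add: chromatic_layer_def chromatic_rep_count_def)
qed

text \<open>Replacing each summand \<open>x\<close> of colour \<open>i\<close> by
  \<open>m i - x\<close> is injective; reversing the lists restores their order. One inequality of
  counts suffices, since reflecting again leads back to \<open>A\<close>.\<close>

lemma chromatic_layer_reflect:
  fixes A :: "'q::finite \<Rightarrow> int set" and m :: "'q \<Rightarrow> int"
  assumes fin: "\<And>i. finite (A i)" and n: "n \<in> chromatic_layer t h A"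
  shows "(\<Sum>i\<in>UNIV. int (h i) * m i) - n \<in> chromatic_layer t h (\<lambda>i. (-) (m i) ` A i)"
    (is "?n \<in> chromatic_layer t h ?B")
proof -
  let ?f = "\<lambda>a i. rev (map ((-) (m i)) (a i))"
  have "sorted (rev (map ((-) x) xs))" if "sorted xs" for x :: int and xs
    using that by (auto simp: sorted_wrt_rev sorted_wrt_map elim: sorted_wrt_mono_rel[rotated])
  then have "?f ` chromatic_reps A h n \<subseteq> chromatic_reps ?B h ?n"
    by (auto simp: chromatic_reps_def sum_list_minus_const sum_subtractf subset_iff)
  moreover have "inj_on ?f (chromatic_reps A h n)"
  proof (rule inj_onI, rule ext)
    fix a a' i assume "?f a = ?f a'"
    then have "map ((-) (m i)) (a i) = map ((-) (m i)) (a' i)"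
      by (metis rev_rev_ident)
    then show "a i = a' i"
      by (rule map_injective) (simp add: inj_on_def)
  qed
  moreover have "finite (chromatic_reps ?B h ?n)"
    using fin by (intro finite_chromatic_reps) auto
  ultimately have "card (chromatic_reps A h n) \<le> card (chromatic_reps ?B h ?n)"
    using card_inj_on_le by blast
  with n show ?thesis
    by (simp add: chromatic_layer_def chromatic_rep_count_def)
qed

text \<open>Mirror image of \<open>chromatic_layer_initial\<close>: the reflected sets are
  nonnegative and the reflected \<open>n\<close> is small. Reflecting back with \<open>h\<close> in
  place of \<open>h'\<close> produces the shift.\<close>

lemma chromatic_layer_final:
  fixes A :: "'q::finite \<Rightarrow> int set" and m :: "'q \<Rightarrow> int"
  assumes fin: "\<And>i. finite (A i)" and ub: "\<And>i x. x \<in> A i \<Longrightarrow> x \<le> m i"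
    and n: "n \<in> chromatic_layer t h' A" and le: "h \<le> h'"
    and large: "\<And>i. (\<Sum>i\<in>UNIV. int (h' i) * m i) - n \<le> int (h i)"
  shows "n - (\<Sum>i\<in>UNIV. int (h' i) * m i) + (\<Sum>i\<in>UNIV. int (h i) * m i) \<in> chromatic_layer t h A"
proof -
  let ?B = "\<lambda>i. (-) (m i) ` A i"
  have finB: "finite (?B i)" for i
    using fin by simp
  have "(\<Sum>i\<in>UNIV. int (h' i) * m i) - n \<in> chromatic_layer t h ?B"
    using ub by (intro chromatic_layer_initial[OF finB _ chromatic_layer_reflect[OF fin n] le large])
      auto
  from chromatic_layer_reflect[OF finB this, of m] show ?thesis
    by (simp add: image_image algebra_simps)
qed

section \<open>Intervals inside layers\<close>

text \<open>The differences of elements of \<open>S\<close> form a subgroup \<open>H\<close> of the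
  integers containing \<open>U\<close>. Its least positive element divides all of \<open>U\<close>,
  so it is 1, and 1 is a difference of two elements of \<open>S\<close>.\<close>

lemma consecutive_in_semigroup:
  fixes S :: "int set"
  assumes zero: "0 \<in> S" and add: "\<And>x y. x \<in> S \<Longrightarrow> y \<in> S \<Longrightarrow> x + y \<in> S"
    and "U \<subseteq> S" "Gcd U = 1"
  obtains s where "s \<in> S" "s + 1 \<in> S"
proof -
  define H where "H = {x - y | x y. x \<in> S \<and> y \<in> S}"
  have diff: "x - y \<in> H" if "x \<in> H" "y \<in> H" for x y
  proof -
    obtain a b c d where "x = a - b" "y = c - d" "a \<in> S" "b \<in> S" "c \<in> S" "d \<in> S"
      using \<open>x \<in> H\<close> \<open>y \<in> H\<close> unfolding H_def by blast
    moreover from this have "x - y = (a + d) - (b + c)" by simp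
    ultimately show ?thesis
      unfolding H_def using add by blast
  qed
  have "0 \<in> H"
    using zero by (force simp: H_def)
  then have uminus: "- x \<in> H" if "x \<in> H" for x
    using diff[of 0 x] that by simp
  then have plus: "x + y \<in> H" if "x \<in> H" "y \<in> H" for x y
    using diff[of x "- y"] that by simp
  have nat_mult: "int k * x \<in> H" if "x \<in> H" for k x
    by (induction k) (use \<open>0 \<in> H\<close> that in \<open>auto simp: distrib_right intro: plus\<close>)
  have mult: "k * x \<in> H" if "x \<in> H" for k x
    using nat_mult[OF that, of "nat k"] uminus[OF nat_mult[OF that, of "nat (- k)"]]
    by (cases "0 \<le> k") simp_all
  have "U \<subseteq> H"
    using \<open>U \<subseteq> S\<close> zero by (force simp: H_def)
  have "\<exists>u\<in>U. u \<noteq> 0"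
    using \<open>Gcd U = 1\<close> Gcd_0_iff[of U] by auto
  then have "\<exists>d::nat. d > 0 \<and> int d \<in> H"
  proof -
    obtain u where "u \<in> U" "u \<noteq> 0"
      using \<open>\<exists>u\<in>U. u \<noteq> 0\<close> by blast
    then have "int (nat \<bar>u\<bar>) \<in> H"
      using \<open>U \<subseteq> H\<close> uminus by (auto simp: abs_if)
    with \<open>u \<noteq> 0\<close> show ?thesis
      by (intro exI[of _ "nat \<bar>u\<bar>"]) auto
  qed
  then obtain d :: nat where d: "d > 0" "int d \<in> H" "\<And>e. e < d \<Longrightarrow> \<not> (e > 0 \<and> int e \<in> H)"
    using exists_least_iff[of "\<lambda>d. d > 0 \<and> int d \<in> H"] by blast
  have "int d dvd u" if "u \<in> U" for u
  proof -
    have "u mod int d \<in> H"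
      using diff[of u "u div int d * int d"] mult[OF d(2)] \<open>U \<subseteq> H\<close> that
      by (auto simp: minus_div_mult_eq_mod)
    moreover have "0 \<le> u mod int d" "u mod int d < int d"
      using d(1) by auto
    ultimately have "u mod int d = 0"
      using d(3)[of "nat (u mod int d)"] by (auto simp: nat_less_iff)
    then show ?thesis by auto
  qed
  then have "int d dvd 1"
    using \<open>Gcd U = 1\<close> Gcd_greatest by metis
  with d have "1 \<in> H" by simp
  then obtain x y where "x \<in> S" "y \<in> S" "x = y + 1"
    unfolding H_def mem_Collect_eq by (metis diff_add_cancel add.commute)
  then show thesis
    using that[of y] by simp
qed

text \<open>If \<open>s\<close> and \<open>s + 1\<close> are sums, then so is
  \<open>m * s + j = (m - j) * s + j * (s + 1)\<close> for each \<open>j \<le> m\<close>. Here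
  \<open>m\<close> is the length of the run, not a maximum.\<close>

lemma chromatic_layer_run:
  fixes A :: "'q::finite \<Rightarrow> int set"
  assumes fin: "\<And>i. finite (A i)" and zero: "\<And>i. 0 \<in> A i" and gcd: "Gcd (\<Union>i. A i) = 1"
  obtains h c where "{c..c + int m} \<subseteq> chromatic_layer 1 h A"
proof -
  define S where "S = (\<Union>h. chromatic_layer 1 h A)"
  have U: "(\<Union>i. A i) \<subseteq> S"
    using chromatic_layer_single[of A, OF fin] unfolding S_def by blast
  then have "0 \<in> S"
    using zero by blast
  have add: "x + y \<in> S" if "x \<in> S" "y \<in> S" for x y
    using that chromatic_layer_add[of A, OF fin] unfolding S_def by blast
  obtain s where s: "s \<in> S" "s + 1 \<in> S"
    using consecutive_in_semigroup[OF \<open>0 \<in> S\<close> add U gcd] by blast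
  have mult: "int k * x \<in> S" if "x \<in> S" for k x
    by (induction k) (use \<open>0 \<in> S\<close> that in \<open>auto simp: distrib_right intro: add\<close>)
  have "int m * s + int j \<in> S" if "j \<le> m" for j
    using add[OF mult[OF s(1), of "m - j"] mult[OF s(2), of j]] that
    by (simp add: of_nat_diff algebra_simps)
  then have "\<exists>h. int m * s + int j \<in> chromatic_layer 1 h A" if "j \<le> m" for j
    using that unfolding S_def by blast
  then obtain H where H: "\<And>j. j \<le> m \<Longrightarrow> int m * s + int j \<in> chromatic_layer 1 (H j) A"
    by metis
  \<comment> \<open>The sum dominates each of the finitely many vectors \<open>H j\<close>, so
    padding by zeros brings the whole run into one layer.\<close>
  define h where "h i = (\<Sum>j\<le>m. H j i)" for i
  have "H j \<le> h" if "j \<le> m" for j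
    using that by (auto simp: h_def le_fun_def intro: member_le_sum)
  then have j: "int m * s + int j \<in> chromatic_layer 1 h A" if "j \<le> m" for j
    using chromatic_layer_mono[of A, OF fin zero H] that by blast
  have "x \<in> chromatic_layer 1 h A" if "x \<in> {int m * s..int m * s + int m}" for x
    using j[of "nat (x - int m * s)"] that by auto
  then show thesis
    by (intro that subsetI)
qed

text \<open>Induction on the number of extra summands. One more summand of colour \<open>i\<close>,
  taken as 0 or \<open>m i\<close>, turns an interval into its union with its translate by
  \<open>m i\<close>; there is no gap because \<open>m i \<le> l\<close>.\<close>

lemma chromatic_layer_interval:
  fixes A :: "'q::finite \<Rightarrow> int set" and m :: "'q \<Rightarrow> int"
  assumes fin: "\<And>i. finite (A i)" and zero: "\<And>i. 0 \<in> A i"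
    and m: "\<And>i. m i \<in> A i" "\<And>i. 0 \<le> m i" "\<And>i. m i \<le> l"
    and run: "{c..c + l} \<subseteq> chromatic_layer t h0 A" and "h0 \<le> h"
  shows "{c..c + l + (\<Sum>i\<in>UNIV. int (h i - h0 i) * m i)} \<subseteq> chromatic_layer t h A"
  using \<open>h0 \<le> h\<close>
proof (induction "\<Sum>i\<in>UNIV. h i - h0 i" arbitrary: h)
  case 0
  then have "h = h0"
    by (auto simp: le_fun_def fun_eq_iff intro: antisym)
  with run show ?case by simp
next
  case (Suc N)
  then obtain i where i: "h0 i < h i"
    by (metis (no_types, lifting) Zero_not_Suc diff_is_0_eq' le_fun_def not_less sum.neutral)
  define h' where "h' = h(i := h i - 1)"
  have h'_le: "h0 \<le> h'"
    using i Suc.prems by (auto simp: h'_def le_fun_def)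
  have "(\<Sum>j\<in>UNIV. h j - h0 j) = (\<Sum>j\<in>UNIV. h' j - h0 j) + 1"
    using i by (simp add: h'_def sum.remove[of UNIV i])
  then have N: "N = (\<Sum>j\<in>UNIV. h' j - h0 j)"
    using Suc.hyps(2) by simp
  have eq: "(\<Sum>j\<in>UNIV. int (h j - h0 j) * m j) = (\<Sum>j\<in>UNIV. int (h' j - h0 j) * m j) + m i"
    using i by (simp add: h'_def sum.remove[of UNIV i] of_nat_diff algebra_simps)
  have h: "(\<lambda>j. h' j + of_bool (j = i)) = h"
    using i by (auto simp: h'_def)
  note IH = Suc.hyps(1)[OF N h'_le]
  show ?case
  proof
    fix x assume x: "x \<in> {c..c + l + (\<Sum>j\<in>UNIV. int (h j - h0 j) * m j)}"
    have step: "x \<in> chromatic_layer t h A" if "y \<in> A i" "x - y \<in> chromatic_layer t h' A" for y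
      using chromatic_layer_add[of A, OF fin that(2) chromatic_layer_single[of A, OF fin that(1)]]
      by (simp add: h)
    show "x \<in> chromatic_layer t h A"
    proof (cases "x \<le> c + l + (\<Sum>j\<in>UNIV. int (h' j - h0 j) * m j)")
      case True
      then show ?thesis
        using IH x zero by (intro step[of 0]) auto
    next
      case False
      moreover have "0 \<le> (\<Sum>j\<in>UNIV. int (h' j - h0 j) * m j)"
        using m(2) by (intro sum_nonneg) simp
      ultimately have "x - m i \<in> {c..c + l + (\<Sum>j\<in>UNIV. int (h' j - h0 j) * m j)}"
        using x eq m(3)[of i] by simp
      then show ?thesis
        using IH m(1) by (intro step[of "m i"]) auto
    qed
  qed
qed

section \<open>Covering the layer of \<open>r h\<close> by translates\<close>

theorem theorem1p17:
  fixes A :: "'q::finite \<Rightarrow> int set" and t r :: nat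
  assumes "\<And>i. finite (A i)" and "\<And>i. A i \<noteq> {}"
    and "normalized A"
    and "\<And>i. Max (A i) \<ge> 1"
    and "t \<ge> 1" and "r \<ge> 1"
  shows "\<exists>h0 :: 'q \<Rightarrow> nat. \<forall>h \<ge> h0. \<exists>X :: int set. finite X \<and> card X \<le> r + 2 \<and>
           chromatic_layer t (\<lambda>i. r * h i) A \<subseteq> X + chromatic_layer t h A"
\<comment> \<open>Layers at threshold \<open>t\<close> may all be empty, as for the single set {0,
  1} and \<open>t = 2\<close>; then the empty \<open>X\<close> works.\<close>
proof (cases "\<exists>h n. n \<in> chromatic_layer t h A")
  case False
  then have "chromatic_layer t h A = {}" for h
    by blast
  then show ?thesis
    by (intro exI[of _ "\<lambda>_. 0"] allI impI exI[of _ "{}"]) auto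
next
  case True
  then obtain g n0 where n0: "n0 \<in> chromatic_layer t g A"
    by blast
  note fin = assms(1)
  have zero: "0 \<in> A i" and nonneg: "x \<in> A i \<Longrightarrow> 0 \<le> x" for i x
    using assms(1-3) Min_in[of "A i"] Min_le[of "A i" x] by (auto simp: normalized_def)
  have gcd: "Gcd (\<Union>i. A i) = 1"
    using assms(3) by (simp add: normalized_def)
  define m where "m i = Max (A i)" for i
  have m: "m i \<in> A i" "1 \<le> m i" "x \<in> A i \<Longrightarrow> x \<le> m i" for i x
    using assms(1,2,4) by (auto simp: m_def)
  have m0: "0 \<le> m i" for i
    using m(2)[of i] by simp
  define l where "l = nat (\<Sum>i\<in>UNIV. m i)"
  have l: "m i \<le> int l" for i
    using member_le_sum[of i UNIV m] m0 by (simp add: l_def)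
  obtain g' c' where run: "{c'..c' + int l} \<subseteq> chromatic_layer 1 g' A"
    using chromatic_layer_run[of A l, OF fin zero gcd] by blast
  define h0 where "h0 = (\<lambda>i. g i + g' i)"
  define c where "c = n0 + c'"
  \<comment> \<open>Translating by \<open>n0\<close>, which has at least \<open>t\<close>
    representations, lifts the run from threshold 1 to threshold \<open>t\<close>.\<close>
  have run: "{c..c + int l} \<subseteq> chromatic_layer t h0 A"
  proof
    fix x assume "x \<in> {c..c + int l}"
    then have "x - n0 \<in> chromatic_layer 1 g' A"
      using run by (auto simp: c_def)
    from chromatic_layer_add[of A, OF fin n0 this] show "x \<in> chromatic_layer t h0 A"
      by (simp add: h0_def)
  qed
  define M where "M h = (\<Sum>i\<in>UNIV. int (h i) * m i)" for h
  \<comment> \<open>Chosen so that the run ends at \<open>M h0 - d\<close>; the right end for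
    \<open>h\<close> is then \<open>M h - d\<close>.\<close>
  define d where "d = M h0 - c - int l"
  have mid: "{c..M h - d} \<subseteq> chromatic_layer t h A" if "h0 \<le> h" for h
  proof -
    have "(\<Sum>i\<in>UNIV. int (h i - h0 i) * m i) = M h - M h0"
      using that by (simp add: M_def le_fun_def of_nat_diff left_diff_distrib sum_subtractf)
    then have "M h - d = c + int l + (\<Sum>i\<in>UNIV. int (h i - h0 i) * m i)"
      by (simp add: d_def)
    then show ?thesis
      using chromatic_layer_interval[of A m, OF fin zero m(1) m0 l run that] by simp
  qed
  \<comment> \<open>Absolute values make \<open>K\<close> a bound for \<open>c\<close>,
    \<open>d\<close> and \<open>c + d\<close> without any discussion of signs.\<close>
  define K where "K = nat \<bar>c\<bar> + nat \<bar>d\<bar>"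
  show ?thesis
  \<comment> \<open>The summand \<open>h0 i\<close> gives access to \<open>mid\<close>. The summand
    \<open>(r + 1) * K\<close> makes \<open>h i\<close> at least \<open>c\<close> and
    \<open>d\<close>, for the two ends, and \<open>M h\<close> at least \<open>(r + 1) * K\<close>,
    for the middle.\<close>
  proof (intro exI[of _ "\<lambda>i. h0 i + (r + 1) * K"] allI impI)
    fix h assume h: "(\<lambda>i. h0 i + (r + 1) * K) \<le> h"
    note h0_K = le_funD[OF h]
    have h0: "h0 \<le> h"
      using add_leD1[OF h0_K] by (rule le_funI)
    have K: "int r * int K + int K \<le> int (h i)" for i
      using add_leD2[OF h0_K[of i], folded of_nat_le_iff[where 'a = int]]
      by (simp add: algebra_simps)
    have "int K \<le> int (h i)" for i
      using order.trans[OF _ K[of i], of "int K"] by simp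
    moreover have "c \<le> int K" "d \<le> int K" "c + d \<le> int K"
      by (auto simp: K_def)
    ultimately have cd: "c + d \<le> int K" "c \<le> int (h i)" "d \<le> int (h i)" for i
      using order.trans by blast+
    \<comment> \<open>An arbitrary colour: its term alone already bounds \<open>M h\<close> from
      below, as \<open>m i0 \<ge> 1\<close>.\<close>
    fix i0 :: 'q
    have "int (h i0) * 1 \<le> int (h i0) * m i0"
      using m(2) by (intro mult_left_mono) auto
    also have "\<dots> \<le> M h"
      unfolding M_def using m0 by (intro member_le_sum) auto
    finally have M: "int r * int K + int K \<le> M h"
      using K[of i0] by (simp add: algebra_simps)
    \<comment> \<open>The number of integers in \<open>{c..M h - d}\<close>, so translates by
      multiples of \<open>w\<close> tile without gaps.\<close>
    define w where "w = M h - d - c + 1"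
    have "0 < w"
      using M cd(1) unfolding w_def by (smt (verit) mult_nonneg_nonneg of_nat_0_le_iff)
    \<comment> \<open>There are \<open>r + 1\<close> multiples of \<open>w\<close> and one further
      shift for the upper end. The lower end costs nothing extra, as 0 is among the
      multiples.\<close>
    define X where "X = insert ((int r - 1) * M h) ((\<lambda>j. int j * w) ` {..r})"
    have "card X \<le> r + 2"
      unfolding X_def using card_insert_le_m1[of "r + 2"] card_image_le[of "{..r}" "\<lambda>j. int j * w"]
      by simp
    moreover have "n \<in> X + chromatic_layer t h A" if n: "n \<in> chromatic_layer t (\<lambda>i. r * h i) A" for n
    proof -
      have *: ?thesis if "x \<in> X" "n - x \<in> chromatic_layer t h A" for x
        using set_plus_intro[OF that] by simp
      have le: "h \<le> (\<lambda>i. r * h i)"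
        using \<open>r \<ge> 1\<close> by (auto simp: le_fun_def)
      have rM: "(\<Sum>i\<in>UNIV. int (r * h i) * m i) = int r * M h"
        by (simp add: M_def sum_distrib_left mult.assoc)
      consider "n < c" | "n > int r * M h - d" | "c \<le> n" "n \<le> int r * M h - d"
        by linarith
      then show ?thesis
      proof cases
        case 1
        then have "n \<in> chromatic_layer t h A"
          using cd(2) by (intro chromatic_layer_initial[OF fin nonneg n le])
            (auto intro: order.trans[OF less_imp_le])
        moreover have "0 \<in> X"
          by (auto simp: X_def intro: image_eqI[of _ _ 0])
        ultimately show ?thesis
          using *[of 0] by simp
      next
        case 2
        have "int r * M h - n \<le> int (h i)" for i
          using 2 cd(3)[of i] by linarith
        then have "n - int r * M h + M h \<in> chromatic_layer t h A"
          using chromatic_layer_final[where m = m, OF fin m(3) n le, unfolded rM, folded M_def]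
          by blast
        then show ?thesis
          by (intro *[of "(int r - 1) * M h"]) (auto simp: X_def algebra_simps)
      next
        case 3
        define j where "j = (n - c) div w"
        have j: "n - c = j * w + (n - c) mod w" "0 \<le> (n - c) mod w" "(n - c) mod w < w"
          using \<open>0 < w\<close> by (auto simp: j_def)
        have "0 \<le> j"
          using 3 \<open>0 < w\<close> by (simp add: j_def pos_imp_zdiv_nonneg_iff)
        \<comment> \<open>The \<open>r + 1\<close> tiles reach far enough:
          \<open>(r + 1) * w\<close> exceeds \<open>r * M h - d - c\<close> by
          \<open>M h - r * (c + d) + r + 1\<close>, which is positive since
          \<open>M h \<ge> (r + 1) * K\<close>.\<close>
        have "int r * (c + d) \<le> int r * int K"
          using cd(1) by (intro mult_left_mono) auto
        then have "n - c < (int r + 1) * w"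
          using M 3 cd(1) by (simp add: w_def algebra_simps)
        then have "j * w < (int r + 1) * w"
          using j(1,2) by linarith
        then have "j < int r + 1"
          using \<open>0 < w\<close> by (simp only: mult_less_cancel_right_pos)
        then have "j * w \<in> X"
          using \<open>0 \<le> j\<close> by (auto simp: X_def intro!: image_eqI[of _ _ "nat j"])
        moreover have "n - j * w \<in> {c..M h - d}"
          using j by (auto simp: w_def)
        ultimately show ?thesis
          using * mid[OF h0] by blast
      qed
    qed
    ultimately show "\<exists>X. finite X \<and> card X \<le> r + 2
        \<and> chromatic_layer t (\<lambda>i. r * h i) A \<subseteq> X + chromatic_layer t h A"
      by (intro exI[of _ X]) (auto simp: X_def)
  qed
qed

end
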